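(* The Bergman space $A^2$ is a reproducing kernel Hilbert space. For $z=m+in$ and $w=u+iv$ in $\mathbb Z^2_+$, its reproducing kernel is given by $$B_w(z)=C(z-\overline w)-C(z-\overline w+2i)=\frac1{2\pi}\int_0^\pi e^{i(m-u)t}\Big(\frac{\cos t}{1+\sin t}\Big)^{n+v}\frac{2\sin t}{1+\sin t}\,dt,$$ where $C$ is the discrete Cauchy kernel.
   Context: Lattice points $(m,n)\in\mathbb Z^2$ are identified with $m+in\in\mathbb C$. Let $\mathbb Z^2_+=\{m+in: m,n\in\mathbb Z,\ n\geqslant 0\}$. A function $f:\mathbb Z^2_+\to\mathbb C$ is discrete holomorphic, written $f\in\operatorname{Hol}(\mathbb Z^2_+)$, if $f(z)+i f(z+1)-f(z+1+i)-i f(z+i)=0$ for every $z\in\mathbb Z^2_+$. The Bergman space is $A^2=A^2(\mathbb Z^2_+)=\{f\in\operatorname{Hol}(\mathbb Z^2_+):\|f\|_{A^2}^2:=\sum_{n=0}^{+\infty}\sum_{m=-\infty}^{+\infty}|f(m+in)|^2<\infty\}$, with the inner product $\langle f,g\rangle_{A^2}=\sum_{n\geqslant0}\sum_{m\in\mathbb Z}f(m+in)\overline{g(m+in)}$. The reproducing kernel at $w$ is the element $B_w\in A^2$ with $f(w)=\langle f,B_w\rangle_{A^2}$ for all $f\in A^2$. The discrete Cauchy kernel on $\mathbb Z^2_+$ is $C(m+in)=\frac1{2\pi}\int_0^\pi e^{imt}\left(\frac{\cos t}{1+\sin t}\right)^n dt$, $m\in\mathbb Z$, $n\geqslant0$.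 *)

theory Defs
  imports "HOL-Analysis.Analysis"
begin

section \<open>Reproducing kernel Hilbert spaces of complex-valued functions\<close>

definition ip_norm :: "(('a \<Rightarrow> complex) \<Rightarrow> ('a \<Rightarrow> complex) \<Rightarrow> complex) \<Rightarrow> ('a \<Rightarrow> complex) \<Rightarrow> real"
  where "ip_norm ip f = sqrt (Re (ip f f))"

text \<open>
  The inner product is linear in its first argument. That \<open>ip f f\<close> is real follows from
  conjugate symmetry.
\<close>

locale hilbert_function_space =
  fixes H :: "('a \<Rightarrow> complex) set"
    and ip :: "('a \<Rightarrow> complex) \<Rightarrow> ('a \<Rightarrow> complex) \<Rightarrow> complex"
  assumes zero_closed: "(\<lambda>_. 0) \<in> H"
    and add_closed: "f \<in> H \<Longrightarrow> g \<in> H \<Longrightarrow> (\<lambda>x. f x + g x) \<in> H"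
    and scale_closed: "f \<in> H \<Longrightarrow> (\<lambda>x. c * f x) \<in> H"
    and ip_add_left: "f \<in> H \<Longrightarrow> g \<in> H \<Longrightarrow> h \<in> H \<Longrightarrow> ip (\<lambda>x. f x + g x) h = ip f h + ip g h"
    and ip_scale_left: "f \<in> H \<Longrightarrow> h \<in> H \<Longrightarrow> ip (\<lambda>x. c * f x) h = c * ip f h"
    and ip_commute: "f \<in> H \<Longrightarrow> g \<in> H \<Longrightarrow> ip f g = cnj (ip g f)"
    and ip_nonneg: "f \<in> H \<Longrightarrow> 0 \<le> Re (ip f f)"
    and ip_definite: "f \<in> H \<Longrightarrow> ip f f = 0 \<Longrightarrow> f = (\<lambda>_. 0)"
    and complete:
      "(\<And>k. F k \<in> H) \<Longrightarrow>
       (\<And>e. e > 0 \<Longrightarrow> \<exists>N. \<forall>j\<ge>N. \<forall>k\<ge>N. ip_norm ip (\<lambda>x. F j x - F k x) < e) \<Longrightarrow>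
       \<exists>f\<in>H. (\<lambda>k. ip_norm ip (\<lambda>x. F k x - f x)) \<longlonglongrightarrow> 0"

locale reproducing_kernel_hilbert_space = hilbert_function_space H ip
  for H :: "('a \<Rightarrow> complex) set"
    and ip :: "('a \<Rightarrow> complex) \<Rightarrow> ('a \<Rightarrow> complex) \<Rightarrow> complex" +
  assumes evaluation_bounded: "\<exists>c. \<forall>f\<in>H. cmod (f x) \<le> c * ip_norm ip f"

definition is_reproducing_kernel_at ::
    "('a \<Rightarrow> complex) set \<Rightarrow> (('a \<Rightarrow> complex) \<Rightarrow> ('a \<Rightarrow> complex) \<Rightarrow> complex) \<Rightarrow>
     'a \<Rightarrow> ('a \<Rightarrow> complex) \<Rightarrow> bool"
  where "is_reproducing_kernel_at H ip w B \<longleftrightarrow> B \<in> H \<and> (\<forall>f\<in>H. f w = ip f B)"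


section \<open>The discrete Bergman space of the upper half-lattice\<close>

text \<open>
  The pair \<open>(m, n)\<close> of type \<open>int \<times> nat\<close> is the point \<open>m + i n\<close> of the upper half-lattice. In these
  coordinates \<open>z - cnj w\<close> is \<open>(m - u, n + v)\<close> for \<open>z = (m, n)\<close> and \<open>w = (u, v)\<close>, and adding \<open>2i\<close>
  to it gives \<open>(m - u, n + v + 2)\<close>.
\<close>

definition lattice_point :: "int \<times> nat \<Rightarrow> complex"
  where "lattice_point z = of_int (fst z) + \<i> * of_nat (snd z)"

lemma lattice_point_diff_cnj:
  "lattice_point (m, n) - cnj (lattice_point (u, v)) = lattice_point (m - u, n + v)"
  "lattice_point (m, n) - cnj (lattice_point (u, v)) + 2 * \<i> = lattice_point (m - u, n + v + 2)"
  by (simp_all add: lattice_point_def algebra_simps)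

definition discrete_holomorphic :: "(int \<times> nat \<Rightarrow> complex) \<Rightarrow> bool"
  where "discrete_holomorphic f \<longleftrightarrow>
    (\<forall>m n. f (m, n) + \<i> * f (m + 1, n) - f (m + 1, n + 1) - \<i> * f (m, n + 1) = 0)"

definition bergman_space :: "(int \<times> nat \<Rightarrow> complex) set"
  where "bergman_space = {f. discrete_holomorphic f \<and> (\<lambda>z. (cmod (f z))\<^sup>2) summable_on UNIV}"

text \<open>
  For \<open>f\<close> and \<open>g\<close> in the Bergman space the double series is absolutely summable, so the unordered
  sum over all lattice points is the iterated sum over rows.
\<close>

definition bergman_inner ::
    "(int \<times> nat \<Rightarrow> complex) \<Rightarrow> (int \<times> nat \<Rightarrow> complex) \<Rightarrow> complex"
  where "bergman_inner f g = (\<Sum>\<^sub>\<infinity>z. f z * cnj (g z))"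

definition bergman_kernel :: "int \<times> nat \<Rightarrow> int \<times> nat \<Rightarrow> complex"
  where "bergman_kernel w = (THE B. is_reproducing_kernel_at bergman_space bergman_inner w B)"

definition discrete_cauchy_kernel :: "int \<times> nat \<Rightarrow> complex"
  where "discrete_cauchy_kernel z =
    1 / (2 * of_real pi) *
    integral {0..pi} (\<lambda>t. exp (\<i> * of_int (fst z) * of_real t) *
                         of_real ((cos t / (1 + sin t)) ^ snd z))"

end

theory Submission
  imports Defs
begin

text \<open>
  On the Fourier side a step upwards multiplies a discrete holomorphic function by
  \<open>r(t) = cos t / (1 + sin t)\<close>, and \<open>\<bar>r(t)\<bar> < 1\<close> exactly on the upper half-circle. Writing \<open>f\<^sub>n\<close> for
  the rows of \<open>f \<in> A\<^sup>2\<close> and \<open>C\<^sub>k\<close> for those of the Cauchy kernel, the holomorphicity relation of both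
  factors, together with the decay of correlations of square-summable sequences, gives
  \<open>\<langle>f\<^sub>n, C\<^sub>k\<^sub>+\<^sub>1(\<cdot> - u)\<rangle> = \<langle>f\<^sub>n\<^sub>+\<^sub>1, C\<^sub>k(\<cdot> - u)\<rangle>\<close> and the same for \<open>cnj C\<close> with both indices moving up.
  Since the rows of \<open>f\<close> tend to \<open>0\<close> in \<open>\<ell>\<^sup>2\<close> while those of \<open>C\<close> stay bounded by Bessel's inequality,
  the correlations with \<open>cnj C\<close> vanish; as \<open>C\<^sub>0 + cnj C\<^sub>0\<close> is the unit mass at \<open>0\<close>, the correlation of
  \<open>f\<^sub>n\<close> with \<open>C\<^sub>k\<close> at \<open>u\<close> is \<open>f(u, n + k)\<close>. The inner product of \<open>f\<close> with the difference of Cauchy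
  kernels is then a telescoping series. This replaces any appeal to the Plancherel theorem.
\<close>

section \<open>Square-summable families\<close>

definition square_summable :: "('a \<Rightarrow> complex) \<Rightarrow> bool"
  where "square_summable f \<longleftrightarrow> (\<lambda>x. (cmod (f x))\<^sup>2) summable_on UNIV"

definition l2_norm :: "('a \<Rightarrow> complex) \<Rightarrow> real"
  where "l2_norm f = sqrt (\<Sum>\<^sub>\<infinity>x. (cmod (f x))\<^sup>2)"

lemma square_summable_bounded:
  assumes "\<And>S. finite S \<Longrightarrow> (\<Sum>x\<in>S. (cmod (f x))\<^sup>2) \<le> b"
  shows "square_summable f"
  unfolding square_summable_def
  by (rule nonneg_bdd_above_summable_on) (use assms in \<open>auto intro!: bdd_aboveI[of _ b]\<close>)

lemma l2_norm_le:
  assumes "\<And>S. finite S \<Longrightarrow> (\<Sum>x\<in>S. (cmod (f x))\<^sup>2) \<le> b\<^sup>2" and "0 \<le> b"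
  shows "l2_norm f \<le> b"
proof -
  have "square_summable f"
    using assms(1) by (rule square_summable_bounded)
  then have "(\<Sum>\<^sub>\<infinity>x. (cmod (f x))\<^sup>2) \<le> b\<^sup>2"
    unfolding square_summable_def by (rule infsum_le_finite_sums) (use assms in auto)
  then show ?thesis
    unfolding l2_norm_def using assms(2) by (simp add: real_le_lsqrt infsum_nonneg)
qed

lemma l2_norm_nonneg: "0 \<le> l2_norm f"
  unfolding l2_norm_def by (simp add: infsum_nonneg)

lemma l2_norm_power2: "(l2_norm f)\<^sup>2 = (\<Sum>\<^sub>\<infinity>x. (cmod (f x))\<^sup>2)"
  unfolding l2_norm_def by (simp add: infsum_nonneg)

lemma sum_le_l2_norm_power2:
  assumes "square_summable f" "finite S"
  shows "(\<Sum>x\<in>S. (cmod (f x))\<^sup>2) \<le> (l2_norm f)\<^sup>2"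
  unfolding l2_norm_power2
  by (rule finite_sum_le_infsum) (use assms in \<open>auto simp: square_summable_def\<close>)

lemma cmod_le_l2_norm:
  assumes "square_summable f"
  shows "cmod (f x) \<le> l2_norm f"
  using sum_le_l2_norm_power2[OF assms, of "{x}"]
  by (auto intro: power2_le_imp_le simp: l2_norm_nonneg)

lemma square_summable_add:
  assumes "square_summable f" "square_summable g"
  shows "square_summable (\<lambda>x. f x + g x)"
proof -
  have *: "(cmod (f x + g x))\<^sup>2 \<le> 2 * (cmod (f x))\<^sup>2 + 2 * (cmod (g x))\<^sup>2" for x
  proof -
    have "(cmod (f x + g x))\<^sup>2 \<le> (cmod (f x) + cmod (g x))\<^sup>2"
      by (intro power_mono norm_triangle_ineq) auto
    also have "\<dots> \<le> 2 * (cmod (f x))\<^sup>2 + 2 * (cmod (g x))\<^sup>2"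
      using sum_squares_bound[of "cmod (f x)" "cmod (g x)"] by (simp add: power2_sum)
    finally show ?thesis .
  qed
  have "(\<lambda>x. 2 * (cmod (f x))\<^sup>2 + 2 * (cmod (g x))\<^sup>2) summable_on UNIV"
    using assms unfolding square_summable_def
    by (intro summable_on_add summable_on_cmult_right)
  then show ?thesis
    unfolding square_summable_def by (rule summable_on_comparison_test) (use * in auto)
qed

lemma square_summable_scale:
  assumes "square_summable f"
  shows "square_summable (\<lambda>x. c * f x)"
  using assms unfolding square_summable_def norm_mult power_mult_distrib
  by (rule summable_on_cmult_right)

lemma square_summable_diff:
  assumes "square_summable f" "square_summable g"
  shows "square_summable (\<lambda>x. f x - g x)"
  using square_summable_add[OF assms(1) square_summable_scale[OF assms(2), of "-1"]] by simp

lemma square_summable_cnj: "square_summable (\<lambda>x. cnj (f x)) \<longleftrightarrow> square_summable f"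
  by (simp add: square_summable_def)

lemma square_summable_comp:
  assumes "square_summable f" "inj h"
  shows "square_summable (\<lambda>x. f (h x))"
proof -
  have "(\<lambda>x. (cmod (f x))\<^sup>2) summable_on range h"
    using assms(1) unfolding square_summable_def by (rule summable_on_subset_banach) simp
  then show ?thesis
    unfolding square_summable_def summable_on_reindex[OF assms(2)] by (simp add: o_def)
qed

lemma l2_norm_shift: "l2_norm (\<lambda>m::int. f (m - u)) = l2_norm f"
proof -
  have "bij (\<lambda>m::int. m - u)"
    by (rule bij_betw_byWitness[where f' = "\<lambda>m. m + u"]) auto
  from infsum_reindex_bij_betw[OF this, of "\<lambda>m. (cmod (f m))\<^sup>2"] show ?thesis
    by (simp add: l2_norm_def)
qed

section \<open>Cauchy-Schwarz inequality and summability of products\<close>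

lemma cauchy_schwarz_finite:
  assumes "square_summable f" "square_summable g" "finite S"
  shows "(\<Sum>x\<in>S. cmod (f x * g x)) \<le> l2_norm f * l2_norm g"
proof (rule power2_le_imp_le)
  have "(\<Sum>x\<in>S. cmod (f x * g x))\<^sup>2 \<le> (\<Sum>x\<in>S. (cmod (f x))\<^sup>2) * (\<Sum>x\<in>S. (cmod (g x))\<^sup>2)"
    unfolding norm_mult by (rule Cauchy_Schwarz_ineq_sum)
  also have "\<dots> \<le> (l2_norm f)\<^sup>2 * (l2_norm g)\<^sup>2"
    by (intro mult_mono sum_le_l2_norm_power2 assms sum_nonneg) auto
  finally show "(\<Sum>x\<in>S. cmod (f x * g x))\<^sup>2 \<le> (l2_norm f * l2_norm g)\<^sup>2"
    by (simp add: power_mult_distrib)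
qed (simp add: l2_norm_nonneg)

lemma square_summable_mult_abs:
  assumes "square_summable f" "square_summable g"
  shows "(\<lambda>x. cmod (f x * g x)) summable_on UNIV"
  by (rule nonneg_bdd_above_summable_on)
     (use cauchy_schwarz_finite[OF assms] in \<open>auto intro!: bdd_aboveI[of _ "l2_norm f * l2_norm g"]\<close>)

lemma square_summable_mult:
  assumes "square_summable f" "square_summable g"
  shows "(\<lambda>x. f x * g x) summable_on UNIV"
  using square_summable_mult_abs[OF assms] by (rule abs_summable_summable)

lemma cauchy_schwarz_infsum:
  assumes "square_summable f" "square_summable g"
  shows "cmod (\<Sum>\<^sub>\<infinity>x. f x * g x) \<le> l2_norm f * l2_norm g"
proof -
  have "cmod (\<Sum>\<^sub>\<infinity>x. f x * g x) \<le> (\<Sum>\<^sub>\<infinity>x. cmod (f x * g x))"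
    by (rule norm_infsum_bound[OF square_summable_mult_abs[OF assms]])
  also have "\<dots> \<le> l2_norm f * l2_norm g"
    by (rule infsum_le_finite_sums[OF square_summable_mult_abs[OF assms]])
       (rule cauchy_schwarz_finite[OF assms])
  finally show ?thesis .
qed

section \<open>Decay of square-summable families and of their correlations\<close>

lemma square_summable_tendsto_zero:
  assumes "square_summable f" "inj (h :: nat \<Rightarrow> 'a)"
  shows "(\<lambda>j. f (h j)) \<longlonglongrightarrow> 0"
proof -
  have "summable (\<lambda>j. (cmod (f (h j)))\<^sup>2)"
    using square_summable_comp[OF assms] unfolding square_summable_def
    by (rule summable_on_imp_summable)
  then have "(\<lambda>j. sqrt ((cmod (f (h j)))\<^sup>2)) \<longlonglongrightarrow> sqrt 0"
    by (intro tendsto_real_sqrt summable_LIMSEQ_zero)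
  then show ?thesis
    by (simp add: tendsto_norm_zero_iff)
qed

lemma square_summable_tail:
  fixes f :: "'a \<Rightarrow> complex"
  assumes "square_summable f" "e > 0"
  obtains S where "finite S" "l2_norm (\<lambda>x. if x \<in> S then 0 else f x) \<le> e"
proof -
  have "0 < e\<^sup>2" using assms(2) by simp
  with assms(1) obtain S where S: "finite S"
    "dist (\<Sum>x\<in>S. (cmod (f x))\<^sup>2) (\<Sum>\<^sub>\<infinity>x. (cmod (f x))\<^sup>2) \<le> e\<^sup>2"
    unfolding square_summable_def using infsum_finite_approximation by blast
  have "l2_norm (\<lambda>x. if x \<in> S then 0 else f x) \<le> e"
  proof (rule l2_norm_le)
    fix T :: "'a set"
    assume "finite T"
    have "(\<Sum>x\<in>T. (cmod (if x \<in> S then 0 else f x))\<^sup>2) = (\<Sum>x\<in>T - S. (cmod (f x))\<^sup>2)"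
      using \<open>finite T\<close> by (intro sum.mono_neutral_cong_right) auto
    also have "\<dots> = (\<Sum>x\<in>(T - S) \<union> S. (cmod (f x))\<^sup>2) - (\<Sum>x\<in>S. (cmod (f x))\<^sup>2)"
      using \<open>finite T\<close> S(1) by (subst sum.union_disjoint) auto
    also have "\<dots> \<le> (l2_norm f)\<^sup>2 - (\<Sum>x\<in>S. (cmod (f x))\<^sup>2)"
      using \<open>finite T\<close> S(1) by (intro diff_right_mono sum_le_l2_norm_power2[OF assms(1)]) auto
    also have "\<dots> \<le> e\<^sup>2"
      using S(2) unfolding l2_norm_power2 dist_real_def by linarith
    finally show "(\<Sum>x\<in>T. (cmod (if x \<in> S then 0 else f x))\<^sup>2) \<le> e\<^sup>2" .
  qed (use assms(2) in simp)
  with S(1) show ?thesis by (rule that)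
qed

text \<open>Cut \<open>a\<close> down to a finite set up to a small error in norm. The finite part
  vanishes in the limit because \<open>b\<close> tends to 0 along injective sequences.
  Cauchy-Schwarz bounds the rest uniformly in \<open>j\<close>, since translation preserves the norm
  of \<open>b\<close>.\<close>

lemma correlation_tendsto_zero:
  fixes a b :: "int \<Rightarrow> complex"
  assumes a: "square_summable a" and b: "square_summable b"
    and h: "inj (h :: nat \<Rightarrow> int)"
  shows "(\<lambda>j. \<Sum>\<^sub>\<infinity>m. a m * b (m - h j)) \<longlonglongrightarrow> 0"
proof (rule LIMSEQ_I)
  fix e :: real
  assume "e > 0"
  \<comment> \<open>The added 1 keeps the quotient defined when \<open>b\<close> vanishes.\<close>
  define d where "d = e / (2 * (l2_norm b + 1))"
  have "d > 0"
    unfolding d_def using \<open>e > 0\<close> l2_norm_nonneg[of b] by simp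
  have d_le: "d * l2_norm b \<le> e / 2"
    unfolding d_def using \<open>e > 0\<close> l2_norm_nonneg[of b] by (simp add: field_simps)
  obtain S where S: "finite S" "l2_norm (\<lambda>m. if m \<in> S then 0 else a m) \<le> d"
    using square_summable_tail[OF a \<open>d > 0\<close>] .
  have bshift: "square_summable (\<lambda>m. b (m - u))" for u
    by (rule square_summable_comp[OF b]) (simp add: inj_on_def)
  have ss: "square_summable (\<lambda>m. if m \<in> S then 0 else a m)"
    using a unfolding square_summable_def
    by (rule summable_on_comparison_test) auto
  have "(\<lambda>j. \<Sum>m\<in>S. a m * b (m - h j)) \<longlonglongrightarrow> (\<Sum>m\<in>S. a m * 0)"
    by (intro tendsto_sum tendsto_mult tendsto_const square_summable_tendsto_zero[OF b])
       (use h in \<open>auto simp: inj_on_def\<close>)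
  then have "(\<lambda>j. \<Sum>m\<in>S. a m * b (m - h j)) \<longlonglongrightarrow> 0" by simp
  then obtain N where N: "\<And>j. j \<ge> N \<Longrightarrow> cmod (\<Sum>m\<in>S. a m * b (m - h j)) < e / 2"
    using LIMSEQ_D[of _ 0 "e / 2"] \<open>e > 0\<close> by fastforce
  show "\<exists>N. \<forall>j\<ge>N. cmod ((\<Sum>\<^sub>\<infinity>m. a m * b (m - h j)) - 0) < e"
  proof (intro exI allI impI)
    fix j assume "j \<ge> N"
    have "(\<Sum>\<^sub>\<infinity>m. a m * b (m - h j)) =
        (\<Sum>\<^sub>\<infinity>m. (if m \<in> S then a m * b (m - h j) else 0) +
          (if m \<in> S then 0 else a m) * b (m - h j))"
      by (intro infsum_cong) auto
    also have "\<dots> = (\<Sum>\<^sub>\<infinity>m. if m \<in> S then a m * b (m - h j) else 0) +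
        (\<Sum>\<^sub>\<infinity>m. (if m \<in> S then 0 else a m) * b (m - h j))"
      by (intro infsum_add square_summable_mult ss bshift finite_nonzero_values_imp_summable_on)
         (rule finite_subset[OF _ S(1)], auto)
    also have "(\<Sum>\<^sub>\<infinity>m. if m \<in> S then a m * b (m - h j) else 0) = (\<Sum>m\<in>S. a m * b (m - h j))"
      unfolding infsum_finite[OF S(1), symmetric] by (rule infsum_cong_neutral) auto
    finally have eq: "(\<Sum>\<^sub>\<infinity>m. a m * b (m - h j)) = (\<Sum>m\<in>S. a m * b (m - h j)) +
        (\<Sum>\<^sub>\<infinity>m. (if m \<in> S then 0 else a m) * b (m - h j))" .
    have "cmod (\<Sum>\<^sub>\<infinity>m. (if m \<in> S then 0 else a m) * b (m - h j)) \<le>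
        l2_norm (\<lambda>m. if m \<in> S then 0 else a m) * l2_norm (\<lambda>m. b (m - h j))"
      by (rule cauchy_schwarz_infsum[OF ss bshift])
    also have "\<dots> \<le> d * l2_norm b"
      unfolding l2_norm_shift by (intro mult_right_mono S(2) l2_norm_nonneg)
    finally have "cmod (\<Sum>\<^sub>\<infinity>m. (if m \<in> S then 0 else a m) * b (m - h j)) \<le> e / 2"
      using d_le by linarith
    with N[OF \<open>j \<ge> N\<close>] show "cmod ((\<Sum>\<^sub>\<infinity>m. a m * b (m - h j)) - 0) < e"
      unfolding eq diff_zero
      by (smt (verit, best) norm_triangle_ineq field_sum_of_halves)
  qed
qed

text \<open>The limit is taken pointwise. For a finite set and a fixed \<open>j\<close>, the Cauchy
  bound survives \<open>k\<close> tending to infinity, and since it does not depend on the set it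
  bounds the whole norm.\<close>

lemma square_summable_complete:
  fixes F :: "nat \<Rightarrow> 'a \<Rightarrow> complex"
  assumes F: "\<And>k. square_summable (F k)"
    and Cauchy: "\<And>e. e > 0 \<Longrightarrow> \<exists>N. \<forall>j\<ge>N. \<forall>k\<ge>N. l2_norm (\<lambda>x. F j x - F k x) < e"
  obtains f where "square_summable f" "\<And>x. (\<lambda>k. F k x) \<longlonglongrightarrow> f x"
    "(\<lambda>k. l2_norm (\<lambda>x. F k x - f x)) \<longlonglongrightarrow> 0"
proof -
  have "Cauchy (\<lambda>k. F k x)" for x
  proof (rule CauchyI)
    fix e :: real
    assume "e > 0"
    from Cauchy[OF this] show "\<exists>N. \<forall>j\<ge>N. \<forall>k\<ge>N. norm (F j x - F k x) < e"
      using cmod_le_l2_norm[OF square_summable_diff[OF F F]] by (meson le_less_trans)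
  qed
  then have "\<forall>x. \<exists>l. (\<lambda>k. F k x) \<longlonglongrightarrow> l"
    by (simp add: Cauchy_convergent_iff convergent_def)
  then obtain f where f: "\<And>x. (\<lambda>k. F k x) \<longlonglongrightarrow> f x"
    by metis
  have tail: "\<exists>N. \<forall>j\<ge>N. \<forall>S. finite S \<longrightarrow> (\<Sum>x\<in>S. (cmod (F j x - f x))\<^sup>2) \<le> e\<^sup>2"
    if e: "e > 0" for e :: real
  proof -
    obtain N where N: "\<And>j k. j \<ge> N \<Longrightarrow> k \<ge> N \<Longrightarrow> l2_norm (\<lambda>x. F j x - F k x) < e"
      using Cauchy[OF e] by blast
    have "(\<Sum>x\<in>S. (cmod (F j x - f x))\<^sup>2) \<le> e\<^sup>2" if "j \<ge> N" "finite S" for j S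
    proof (rule LIMSEQ_le_const2)
      show "(\<lambda>k. \<Sum>x\<in>S. (cmod (F j x - F k x))\<^sup>2) \<longlonglongrightarrow> (\<Sum>x\<in>S. (cmod (F j x - f x))\<^sup>2)"
        by (intro tendsto_intros f)
      have "(\<Sum>x\<in>S. (cmod (F j x - F k x))\<^sup>2) \<le> e\<^sup>2" if "k \<ge> N" for k
      proof -
        have "(\<Sum>x\<in>S. (cmod (F j x - F k x))\<^sup>2) \<le> (l2_norm (\<lambda>x. F j x - F k x))\<^sup>2"
          using \<open>finite S\<close> by (intro sum_le_l2_norm_power2 square_summable_diff F)
        also have "\<dots> \<le> e\<^sup>2"
          using N[OF \<open>j \<ge> N\<close> that] by (intro power_mono l2_norm_nonneg) auto
        finally show ?thesis .
      qed
      then show "\<exists>N. \<forall>k\<ge>N. (\<Sum>x\<in>S. (cmod (F j x - F k x))\<^sup>2) \<le> e\<^sup>2" by blast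
    qed
    then show ?thesis by blast
  qed
  \<comment> \<open>One index at finite distance from \<open>f\<close> suffices, because
    \<open>f = F j - (F j - f)\<close>.\<close>
  obtain j where "\<And>S. finite S \<Longrightarrow> (\<Sum>x\<in>S. (cmod (F j x - f x))\<^sup>2) \<le> 1\<^sup>2"
    using tail[of 1] by auto
  then have "square_summable (\<lambda>x. F j x - f x)"
    by (rule square_summable_bounded)
  from square_summable_diff[OF F[of j] this] have "square_summable f" by simp
  moreover have "(\<lambda>k. l2_norm (\<lambda>x. F k x - f x)) \<longlonglongrightarrow> 0"
  proof (rule LIMSEQ_I)
    fix e :: real
    assume "e > 0"
    then obtain N where "\<And>j S. j \<ge> N \<Longrightarrow> finite S \<Longrightarrow>
        (\<Sum>x\<in>S. (cmod (F j x - f x))\<^sup>2) \<le> (e / 2)\<^sup>2"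
      using tail[of "e / 2"] by auto
    then have "l2_norm (\<lambda>x. F j x - f x) \<le> e / 2" if "j \<ge> N" for j
      using that \<open>e > 0\<close> by (intro l2_norm_le) auto
    then show "\<exists>N. \<forall>k\<ge>N. norm (l2_norm (\<lambda>x. F k x - f x) - 0) < e"
      using \<open>e > 0\<close> by (auto simp: l2_norm_nonneg intro!: exI[of _ N]) force
  qed
  ultimately show ?thesis using f by (intro that)
qed

section \<open>The Bergman space as a Hilbert space\<close>

text \<open>Both kernels evaluate their difference \<open>D\<close> at \<open>w\<close> to the same
  number, so \<open>ip D D = 0\<close>.\<close>

lemma reproducing_kernel_unique:
  assumes "hilbert_function_space H ip"
    and "is_reproducing_kernel_at H ip w B" "is_reproducing_kernel_at H ip w B'"
  shows "B = B'"
proof -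
  interpret hilbert_function_space H ip by fact
  have mem: "B \<in> H" "B' \<in> H" and rep: "\<And>f. f \<in> H \<Longrightarrow> ip f B = ip f B'"
    using assms(2,3) by (auto simp: is_reproducing_kernel_at_def)
  have sc: "(\<lambda>x. (-1) * B' x) \<in> H"
    using mem by (intro scale_closed)
  \<comment> \<open>The difference is written with \<open>+\<close> and a factor \<open>-1\<close>
    because the locale speaks only of sums and multiples.\<close>
  define D where "D = (\<lambda>x. B x + (-1) * B' x)"
  have D: "D \<in> H"
    unfolding D_def by (rule add_closed[OF mem(1) sc])
  have "ip D D = ip B D + ip (\<lambda>x. (-1) * B' x) D"
    using ip_add_left[OF mem(1) sc D] by (simp add: D_def)
  also have "\<dots> = ip B D - ip B' D"
    using ip_scale_left[OF mem(2) D, of "-1"] by simp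
  also have "\<dots> = cnj (ip D B) - cnj (ip D B')"
    using ip_commute[OF mem(1) D] ip_commute[OF mem(2) D] by simp
  also have "\<dots> = 0"
    using rep[OF D] by simp
  finally have "D = (\<lambda>_. 0)"
    using ip_definite[OF D] by blast
  then show ?thesis
    unfolding D_def by (simp add: fun_eq_iff)
qed

lemma bergman_space_iff: "f \<in> bergman_space \<longleftrightarrow> discrete_holomorphic f \<and> square_summable f"
  by (simp add: bergman_space_def square_summable_def)

lemma bergman_inner_self:
  assumes "square_summable f"
  shows "bergman_inner f f = of_real ((l2_norm f)\<^sup>2)"
proof -
  have "((\<lambda>x. complex_of_real ((cmod (f x))\<^sup>2)) has_sum of_real ((l2_norm f)\<^sup>2)) UNIV"
    using assms unfolding has_sum_of_real_iff l2_norm_power2 square_summable_def by simp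
  then show ?thesis
    unfolding bergman_inner_def by (simp add: infsumI flip: complex_norm_square)
qed

lemma ip_norm_bergman:
  assumes "square_summable f"
  shows "ip_norm bergman_inner f = l2_norm f"
  by (simp add: ip_norm_def bergman_inner_self[OF assms] l2_norm_nonneg)

section \<open>Closure of discrete holomorphy under linear operations and limits\<close>

lemma discrete_holomorphic_add:
  assumes "discrete_holomorphic f" "discrete_holomorphic g"
  shows "discrete_holomorphic (\<lambda>z. f z + g z)"
proof -
  have "(f (m, n) + g (m, n)) + \<i> * (f (m + 1, n) + g (m + 1, n))
      - (f (m + 1, n + 1) + g (m + 1, n + 1)) - \<i> * (f (m, n + 1) + g (m, n + 1)) =
      (f (m, n) + \<i> * f (m + 1, n) - f (m + 1, n + 1) - \<i> * f (m, n + 1)) +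
      (g (m, n) + \<i> * g (m + 1, n) - g (m + 1, n + 1) - \<i> * g (m, n + 1))" for m n
    by (simp add: algebra_simps)
  then show ?thesis
    using assms by (simp only: discrete_holomorphic_def add_0 simp_thms)
qed

lemma discrete_holomorphic_scale:
  assumes "discrete_holomorphic f"
  shows "discrete_holomorphic (\<lambda>z. c * f z)"
proof -
  have "c * f (m, n) + \<i> * (c * f (m + 1, n)) - c * f (m + 1, n + 1) - \<i> * (c * f (m, n + 1)) =
      c * (f (m, n) + \<i> * f (m + 1, n) - f (m + 1, n + 1) - \<i> * f (m, n + 1))" for m n
    by (simp add: algebra_simps)
  then show ?thesis
    using assms unfolding discrete_holomorphic_def by simp
qed

text \<open>Each instance of the relation involves only four lattice points, so pointwise
  convergence is enough. This makes the Bergman space closed.\<close>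

lemma discrete_holomorphic_limit:
  assumes "\<And>k. discrete_holomorphic (F k)" "\<And>z. (\<lambda>k. F k z) \<longlonglongrightarrow> f z"
  shows "discrete_holomorphic f"
  unfolding discrete_holomorphic_def
proof (intro allI)
  fix m n
  have "(\<lambda>k. F k (m, n) + \<i> * F k (m + 1, n) - F k (m + 1, n + 1) - \<i> * F k (m, n + 1))
      \<longlonglongrightarrow> f (m, n) + \<i> * f (m + 1, n) - f (m + 1, n + 1) - \<i> * f (m, n + 1)"
    by (intro tendsto_intros assms(2))
  then show "f (m, n) + \<i> * f (m + 1, n) - f (m + 1, n + 1) - \<i> * f (m, n + 1) = 0"
    using assms(1) unfolding discrete_holomorphic_def by (simp add: LIMSEQ_const_iff)
qed

lemma bergman_hilbert: "hilbert_function_space bergman_space bergman_inner"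
proof
  show "(\<lambda>_. 0) \<in> bergman_space"
    by (simp add: bergman_space_def discrete_holomorphic_def)
next
  fix f g :: "int \<times> nat \<Rightarrow> complex"
  assume "f \<in> bergman_space" "g \<in> bergman_space"
  then show "(\<lambda>x. f x + g x) \<in> bergman_space"
    by (simp add: bergman_space_iff discrete_holomorphic_add square_summable_add)
next
  fix f :: "int \<times> nat \<Rightarrow> complex" and c
  assume "f \<in> bergman_space"
  then show "(\<lambda>x. c * f x) \<in> bergman_space"
    by (simp add: bergman_space_iff discrete_holomorphic_scale square_summable_scale)
next
  fix f g h :: "int \<times> nat \<Rightarrow> complex"
  assume "f \<in> bergman_space" "g \<in> bergman_space" "h \<in> bergman_space"
  then show "bergman_inner (\<lambda>x. f x + g x) h = bergman_inner f h + bergman_inner g h"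
    unfolding bergman_inner_def distrib_right bergman_space_iff
    by (intro infsum_add square_summable_mult) (auto simp: square_summable_cnj)
next
  fix f h :: "int \<times> nat \<Rightarrow> complex" and c
  show "bergman_inner (\<lambda>x. c * f x) h = c * bergman_inner f h"
    unfolding bergman_inner_def mult.assoc by (rule infsum_cmult_right')
next
  fix f g :: "int \<times> nat \<Rightarrow> complex"
  show "bergman_inner f g = cnj (bergman_inner g f)"
    unfolding bergman_inner_def by (simp add: mult.commute flip: infsum_cnj)
next
  fix f :: "int \<times> nat \<Rightarrow> complex"
  assume f: "f \<in> bergman_space"
  then show "0 \<le> Re (bergman_inner f f)"
    by (simp add: bergman_inner_self bergman_space_iff)
  assume "bergman_inner f f = 0"
  with f have "l2_norm f = 0"
    by (simp add: bergman_inner_self bergman_space_iff)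
  with f show "f = (\<lambda>_. 0)"
    using cmod_le_l2_norm[of f] by (auto simp: bergman_space_iff)
next
  fix F :: "nat \<Rightarrow> int \<times> nat \<Rightarrow> complex"
  assume F: "\<And>k. F k \<in> bergman_space"
    and C: "\<And>e. e > 0 \<Longrightarrow> \<exists>N. \<forall>j\<ge>N. \<forall>k\<ge>N. ip_norm bergman_inner (\<lambda>x. F j x - F k x) < e"
  have ss: "square_summable (F k)" and holo: "discrete_holomorphic (F k)" for k
    using F by (auto simp: bergman_space_iff)
  have C': "\<exists>N. \<forall>j\<ge>N. \<forall>k\<ge>N. l2_norm (\<lambda>x. F j x - F k x) < e" if "e > 0" for e
    using C[OF that] by (simp add: ip_norm_bergman square_summable_diff ss)
  obtain f where f: "square_summable f" "\<And>x. (\<lambda>k. F k x) \<longlonglongrightarrow> f x"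
    "(\<lambda>k. l2_norm (\<lambda>x. F k x - f x)) \<longlonglongrightarrow> 0"
    using square_summable_complete[of F, OF ss C'] by blast
  have "f \<in> bergman_space"
    using discrete_holomorphic_limit[OF holo f(2)] f(1) by (simp add: bergman_space_iff)
  moreover have "(\<lambda>k. ip_norm bergman_inner (\<lambda>x. F k x - f x)) \<longlonglongrightarrow> 0"
    using f(3) by (simp add: ip_norm_bergman square_summable_diff ss f(1))
  ultimately show "\<exists>f\<in>bergman_space. (\<lambda>k. ip_norm bergman_inner (\<lambda>x. F k x - f x)) \<longlonglongrightarrow> 0"
    by blast
qed

lemma bergman_rkhs: "reproducing_kernel_hilbert_space bergman_space bergman_inner"
proof -
  interpret hilbert_function_space bergman_space bergman_inner
    by (rule bergman_hilbert)
  show ?thesis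
  proof
    fix x
    show "\<exists>c. \<forall>f\<in>bergman_space. cmod (f x) \<le> c * ip_norm bergman_inner f"
      \<comment> \<open>The constant 1 works because the squared value at \<open>x\<close> is one
        term of the squared norm.\<close>
      by (rule exI[of _ 1]) (simp add: bergman_space_iff ip_norm_bergman cmod_le_l2_norm)
  qed
qed

section \<open>Fourier coefficients on the upper half-circle\<close>

definition character :: "int \<Rightarrow> real \<Rightarrow> complex"
  where "character m t = exp (\<i> * of_int m * of_real t)"

text \<open>These are full-circle Fourier coefficients of \<open>h\<close> extended by 0 to the
  lower half-circle. The exponent has the opposite of the usual sign, to match the Cauchy
  kernel.\<close>

definition half_coeff :: "(real \<Rightarrow> real) \<Rightarrow> int \<Rightarrow> complex"
  where "half_coeff h m = 1 / (2 * of_real pi) * integral {0..pi} (\<lambda>t. character m t * of_real (h t))"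

lemma character_add: "character (m + k) t = character m t * character k t"
  by (simp add: character_def algebra_simps flip: exp_add)

lemma cnj_character: "cnj (character m t) = character (- m) t"
  by (simp add: character_def exp_cnj)

lemma character_one: "character 1 t = of_real (cos t) + \<i> * of_real (sin t)"
  by (simp add: character_def exp_Euler cos_of_real sin_of_real)

lemma character_reflect: "character m (- t) = character (- m) t"
  by (simp add: character_def)

lemma continuous_on_character [continuous_intros]: "continuous_on S (character m)"
  unfolding character_def by (intro continuous_intros)

lemma integral_character:
  "integral {- pi..pi} (character k) = (if k = 0 then 2 * of_real pi else 0)"
proof (cases "k = 0")
  case True
  then have "character k = (\<lambda>_. 1)"
    by (simp add: character_def fun_eq_iff)
  then show ?thesis
    using True by (simp add: content_real scaleR_conv_of_real)
next
  case False
  have "((\<lambda>t. exp (\<i> * of_int k * of_real t)) has_integral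
      exp (\<i> * of_int k * of_real pi) / (\<i> * of_int k) -
      exp (\<i> * of_int k * of_real (- pi)) / (\<i> * of_int k)) {- pi..pi}"
  proof (rule fundamental_theorem_of_calculus)
    fix x :: real
    have "((\<lambda>z. exp (\<i> * of_int k * z) / (\<i> * of_int k)) has_field_derivative
        exp (\<i> * of_int k * of_real x)) (at (of_real x))"
      using False by (auto intro!: derivative_eq_intros)
    then show "((\<lambda>t. exp (\<i> * of_int k * of_real t) / (\<i> * of_int k)) has_vector_derivative
        exp (\<i> * of_int k * of_real x)) (at x within {- pi..pi})"
      by (rule has_vector_derivative_real_field[THEN has_vector_derivative_at_within])
  qed simp
  moreover have "exp (\<i> * of_int k * of_real pi) = exp (\<i> * of_int k * of_real (- pi))"
    unfolding exp_eq by (rule exI[of _ k]) (simp add: algebra_simps)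
  ultimately show ?thesis
    using False by (simp add: character_def[abs_def] integral_unique)
qed

lemma half_coeff_integrable:
  assumes "continuous_on {0..pi} h"
  shows "(\<lambda>t. character m t * of_real (h t)) integrable_on {0..pi}"
  by (intro integrable_continuous_interval continuous_intros assms)

text \<open>The reflection of \<open>t\<close> turns the conjugate term into the integral over the lower half-circle.\<close>

lemma half_coeff_one_plus_cnj:
  "half_coeff (\<lambda>_. 1) m + cnj (half_coeff (\<lambda>_. 1) m) = (if m = 0 then 1 else 0)"
proof -
  have int: "character m integrable_on S" if "S = {a..b}" for S and a b :: real
    unfolding that by (intro integrable_continuous_interval continuous_intros)
  have "cnj (integral {0..pi} (character m)) = integral {0..pi} (\<lambda>t. character m (- t))"
    by (simp add: integral_cnj cnj_character character_reflect)
  also have "\<dots> = integral {- pi..0} (character m)"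
    using Henstock_Kurzweil_Integration.integral_reflect_real[of "0" "- pi" "character m"] by simp
  finally have "integral {0..pi} (character m) + cnj (integral {0..pi} (character m)) =
      integral {- pi..pi} (character m)"
    using Henstock_Kurzweil_Integration.integral_combine[of "- pi" 0 pi "character m"] int
    by (simp add: add.commute)
  then show ?thesis
    by (simp add: half_coeff_def integral_character divide_simps flip: distrib_left)
qed

text \<open>Parseval's identity for trigonometric polynomials: expanding the square gives characters
  of index \<open>m - k\<close>, and a full period keeps only the diagonal.\<close>

lemma integral_trig_poly:
  assumes "finite S"
  shows "integral {- pi..pi} (\<lambda>t. (cmod (\<Sum>m\<in>S. cnj (a m) * character m t))\<^sup>2) =
    2 * pi * (\<Sum>m\<in>S. (cmod (a m))\<^sup>2)"
proof -
  let ?p = "\<lambda>t. \<Sum>m\<in>S. cnj (a m) * character m t"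
  have sq: "of_real ((cmod (?p t))\<^sup>2) =
      (\<Sum>m\<in>S. \<Sum>k\<in>S. cnj (a m) * a k * character (m - k) t)" for t
    unfolding complex_norm_square cnj_sum sum_product
    by (intro sum.cong refl) (simp add: cnj_character diff_conv_add_uminus character_add del: add_uminus_conv_diff)
  have int: "character k integrable_on {- pi..pi}" for k
    by (intro integrable_continuous_interval continuous_intros)
  have "complex_of_real (integral {- pi..pi} (\<lambda>t. (cmod (?p t))\<^sup>2)) =
      integral {- pi..pi} (\<lambda>t. of_real ((cmod (?p t))\<^sup>2))"
    by (intro integral_unique[symmetric] has_integral_of_real integrable_integral
        integrable_continuous_interval continuous_intros)
  also have "\<dots> = (\<Sum>m\<in>S. \<Sum>k\<in>S. cnj (a m) * a k * integral {- pi..pi} (character (m - k)))"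
    unfolding sq using assms
    by (subst Henstock_Kurzweil_Integration.integral_sum, simp, intro Henstock_Kurzweil_Integration.integrable_sum integrable_on_mult_right int, simp)
       (simp add: Henstock_Kurzweil_Integration.integral_sum integrable_on_mult_right int)
  also have "\<dots> = (\<Sum>m\<in>S. \<Sum>k\<in>S. if m = k then 2 * of_real pi * (cnj (a m) * a m) else 0)"
    by (intro sum.cong refl) (simp add: integral_character)
  also have "\<dots> = of_real (2 * pi * (\<Sum>m\<in>S. (cmod (a m))\<^sup>2))"
    using assms by (simp add: sum.delta sum_distrib_left complex_norm_square mult.commute flip: of_real_power)
  finally show ?thesis
    unfolding of_real_eq_iff .
qed

text \<open>Bessel's inequality follows from \<open>0 \<le> \<integral>\<bar>h - p\<bar>\<^sup>2\<close> over the upper half-circle, where \<open>p\<close> is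
  the trigonometric polynomial with the coefficients of \<open>h\<close>: the norm of \<open>p\<close> over the half-circle
  is at most that over the full circle.\<close>

lemma half_coeff_bessel:
  assumes h: "continuous_on {0..pi} h" and S: "finite S"
  shows "2 * pi * (\<Sum>m\<in>S. (cmod (half_coeff h m))\<^sup>2) \<le> integral {0..pi} (\<lambda>t. (h t)\<^sup>2)"
proof -
  let ?a = "half_coeff h"
  \<comment> \<open>As \<open>h\<close> is real, \<open>cnj (?a m)\<close> is its Fourier
    coefficient in the usual sign convention, which makes \<open>?q\<close> the partial Fourier sum
    over \<open>S\<close>.\<close>
  let ?q = "\<lambda>t. \<Sum>m\<in>S. cnj (?a m) * character m t"
  let ?N = "\<Sum>m\<in>S. (cmod (?a m))\<^sup>2"
  have cross: "integral {0..pi} (\<lambda>t. h t * Re (?q t)) = 2 * pi * ?N"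
  proof -
    have "integral {0..pi} (\<lambda>t. h t * Re (?q t)) =
        integral {0..pi} (\<lambda>t. Re (\<Sum>m\<in>S. cnj (?a m) * (character m t * of_real (h t))))"
      by (intro Henstock_Kurzweil_Integration.integral_cong) (simp add: sum_distrib_left algebra_simps)
    also have "\<dots> = Re (integral {0..pi} (\<lambda>t. \<Sum>m\<in>S. cnj (?a m) * (character m t * of_real (h t))))"
      by (intro integral_unique has_integral_Re integrable_integral Henstock_Kurzweil_Integration.integrable_sum integrable_on_mult_right half_coeff_integrable h S)
    also have "\<dots> = Re (\<Sum>m\<in>S. cnj (?a m) * integral {0..pi} (\<lambda>t. character m t * of_real (h t)))"
      using S by (simp add: Henstock_Kurzweil_Integration.integral_sum integrable_on_mult_right half_coeff_integrable h)
    also have "\<dots> = Re (\<Sum>m\<in>S. cnj (?a m) * (2 * of_real pi * ?a m))"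
      by (simp add: half_coeff_def)
    also have "(\<Sum>m\<in>S. cnj (?a m) * (2 * of_real pi * ?a m)) = of_real (2 * pi * ?N)"
      unfolding of_real_mult of_real_sum complex_norm_square sum_distrib_left
      by (simp add: algebra_simps)
    finally show ?thesis by simp
  qed
  have intR: "g integrable_on {0..pi}" if "continuous_on {0..pi} g" for g :: "real \<Rightarrow> real"
    using that by (rule integrable_continuous_interval)
  \<comment> \<open>The pointwise form of \<open>0 \<le> \<bar>h - ?q\<bar>\<^sup>2\<close>.\<close>
  have pt: "2 * (h t * Re (?q t)) - (cmod (?q t))\<^sup>2 \<le> (h t)\<^sup>2" for t
  proof -
    have "h t * Re (?q t) \<le> \<bar>h t\<bar> * \<bar>Re (?q t)\<bar>"
      by (metis abs_ge_self abs_mult)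
    also have "\<dots> \<le> \<bar>h t\<bar> * cmod (?q t)"
      by (intro mult_left_mono abs_Re_le_cmod abs_ge_zero)
    finally have "h t * Re (?q t) \<le> \<bar>h t\<bar> * cmod (?q t)" .
    moreover have "2 * \<bar>h t\<bar> * cmod (?q t) \<le> \<bar>h t\<bar>\<^sup>2 + (cmod (?q t))\<^sup>2"
      by (rule sum_squares_bound)
    ultimately show ?thesis by simp
  qed
  have "integral {0..pi} (\<lambda>t. (cmod (?q t))\<^sup>2) \<le> integral {- pi..pi} (\<lambda>t. (cmod (?q t))\<^sup>2)"
    by (intro integral_subset_le integrable_continuous_interval continuous_intros) auto
  also have "\<dots> = 2 * pi * ?N"
    by (rule integral_trig_poly[OF S])
  finally have "2 * pi * ?N \<le> 2 * integral {0..pi} (\<lambda>t. h t * Re (?q t)) -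
      integral {0..pi} (\<lambda>t. (cmod (?q t))\<^sup>2)"
    unfolding cross by simp
  also have "\<dots> = integral {0..pi} (\<lambda>t. 2 * (h t * Re (?q t)) - (cmod (?q t))\<^sup>2)"
    by (subst Henstock_Kurzweil_Integration.integral_diff) (auto intro!: intR continuous_intros h)
  also have "\<dots> \<le> integral {0..pi} (\<lambda>t. (h t)\<^sup>2)"
    by (intro integral_le intR continuous_intros h pt)
  finally show ?thesis .
qed

section \<open>The discrete Cauchy kernel\<close>

text \<open>On \<open>{0..pi}\<close> this is \<open>tan (pi / 4 - t / 2)\<close>, which falls from
  1 to -1.\<close>

definition multiplier :: "real \<Rightarrow> real"
  where "multiplier t = cos t / (1 + sin t)"

lemma one_plus_sin_pos: "0 < 1 + sin t" if "t \<in> {0..pi}"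
  using that sin_ge_zero[of t] by auto

lemma continuous_on_multiplier: "continuous_on {0..pi} multiplier"
  unfolding multiplier_def
  using one_plus_sin_pos by (intro continuous_intros) (metis less_irrefl)

text \<open>By \<open>cos\<^sup>2 = (1 - sin) (1 + sin)\<close> the square is
  \<open>(1 - sin t) / (1 + sin t)\<close>. The right-hand side is the density in the integral
  formula for the kernel.\<close>

lemma one_minus_multiplier_power2:
  assumes "t \<in> {0..pi}"
  shows "1 - (multiplier t)\<^sup>2 = 2 * sin t / (1 + sin t)"
  using one_plus_sin_pos[OF assms] cos_squared_eq[of t]
  by (simp add: multiplier_def power_divide divide_simps) (simp add: power2_eq_square algebra_simps)

lemma multiplier_power2_le_one:
  assumes "t \<in> {0..pi}"
  shows "(multiplier t)\<^sup>2 \<le> 1"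
proof -
  have "0 \<le> 2 * sin t / (1 + sin t)"
    using assms one_plus_sin_pos[OF assms] sin_ge_zero[of t] by auto
  then show ?thesis
    using one_minus_multiplier_power2[OF assms] by linarith
qed

text \<open>This identity makes \<open>character m t * multiplier t ^ n\<close> discrete holomorphic
  in \<open>(m, n)\<close> for each fixed \<open>t\<close>. Its real and imaginary parts are the two
  equations for \<open>multiplier t\<close> in the proof.\<close>

lemma multiplier_holomorphic:
  assumes "t \<in> {0..pi}"
  shows "1 + \<i> * character 1 t = of_real (multiplier t) * (character 1 t + \<i>)"
proof -
  have "multiplier t * (1 + sin t) = cos t"
    using one_plus_sin_pos[OF assms] by (simp add: multiplier_def)
  moreover have "multiplier t * cos t = 1 - sin t"
    using one_plus_sin_pos[OF assms] cos_squared_eq[of t]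
    by (simp add: multiplier_def divide_simps) (simp add: power2_eq_square algebra_simps)
  ultimately show ?thesis
    by (simp add: complex_eq_iff character_one algebra_simps)
qed

lemma discrete_cauchy_kernel_eq:
  "discrete_cauchy_kernel (m, n) = half_coeff (\<lambda>t. multiplier t ^ n) m"
  by (simp add: discrete_cauchy_kernel_def half_coeff_def character_def multiplier_def)

lemma half_coeff_diff:
  assumes "continuous_on {0..pi} g" "continuous_on {0..pi} h"
  shows "half_coeff (\<lambda>t. g t - h t) m = half_coeff g m - half_coeff h m"
  unfolding half_coeff_def right_diff_distrib[symmetric]
  by (subst Henstock_Kurzweil_Integration.integral_diff[symmetric]) (simp_all add: half_coeff_integrable assms right_diff_distrib)

lemma half_coeff_cong:
  assumes "\<And>t. t \<in> {0..pi} \<Longrightarrow> g t = h t"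
  shows "half_coeff g m = half_coeff h m"
  unfolding half_coeff_def by (intro arg_cong2[where f = "(*)"] refl Henstock_Kurzweil_Integration.integral_cong) (simp add: assms)

text \<open>The integrand satisfies the relation for every \<open>t\<close>, and the relation is
  linear.\<close>

lemma discrete_holomorphic_cauchy_kernel: "discrete_holomorphic discrete_cauchy_kernel"
  unfolding discrete_holomorphic_def
proof (intro allI)
  fix m :: int and n :: nat
  let ?g = "\<lambda>k n t. character k t * complex_of_real (multiplier t ^ n)"
  have int: "?g k n integrable_on {0..pi}" for k n
    by (intro half_coeff_integrable continuous_intros continuous_on_multiplier)
  have "integral {0..pi} (?g m n) + \<i> * integral {0..pi} (?g (m + 1) n) -
      integral {0..pi} (?g (m + 1) (n + 1)) - \<i> * integral {0..pi} (?g m (n + 1)) =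
      integral {0..pi} (\<lambda>t. ?g m n t + \<i> * ?g (m + 1) n t - ?g (m + 1) (n + 1) t - \<i> * ?g m (n + 1) t)"
    by (simp only: Henstock_Kurzweil_Integration.integral_mult_right Henstock_Kurzweil_Integration.integral_add Henstock_Kurzweil_Integration.integral_diff int
        Henstock_Kurzweil_Integration.integrable_add Henstock_Kurzweil_Integration.integrable_diff integrable_on_mult_right)
  also have "\<dots> = integral {0..pi} (\<lambda>_. 0)"
  proof (rule Henstock_Kurzweil_Integration.integral_cong)
    fix t assume t: "t \<in> {0..pi}"
    have "?g m n t + \<i> * ?g (m + 1) n t - ?g (m + 1) (n + 1) t - \<i> * ?g m (n + 1) t =
        ?g m n t * ((1 + \<i> * character 1 t) - of_real (multiplier t) * (character 1 t + \<i>))"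
      by (simp add: character_add algebra_simps)
    then show "?g m n t + \<i> * ?g (m + 1) n t - ?g (m + 1) (n + 1) t - \<i> * ?g m (n + 1) t = 0"
      unfolding multiplier_holomorphic[OF t] by simp
  qed
  finally have *: "integral {0..pi} (?g m n) + \<i> * integral {0..pi} (?g (m + 1) n) -
      integral {0..pi} (?g (m + 1) (n + 1)) - \<i> * integral {0..pi} (?g m (n + 1)) = 0"
    by simp
  have "discrete_cauchy_kernel (m, n) + \<i> * discrete_cauchy_kernel (m + 1, n)
      - discrete_cauchy_kernel (m + 1, n + 1) - \<i> * discrete_cauchy_kernel (m, n + 1) =
      1 / (2 * of_real pi) * (integral {0..pi} (?g m n) + \<i> * integral {0..pi} (?g (m + 1) n) -
      integral {0..pi} (?g (m + 1) (n + 1)) - \<i> * integral {0..pi} (?g m (n + 1)))"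
    unfolding discrete_cauchy_kernel_eq half_coeff_def by (simp only: algebra_simps)
  then show "discrete_cauchy_kernel (m, n) + \<i> * discrete_cauchy_kernel (m + 1, n)
      - discrete_cauchy_kernel (m + 1, n + 1) - \<i> * discrete_cauchy_kernel (m, n + 1) = 0"
    unfolding * by simp
qed

text \<open>Bessel's inequality with \<open>\<bar>multiplier t\<bar> \<le> 1\<close>. The point is
  that the bound does not depend on the row \<open>n\<close>.\<close>

lemma cauchy_kernel_row_bound:
  assumes "finite S"
  shows "(\<Sum>m\<in>S. (cmod (discrete_cauchy_kernel (m, n)))\<^sup>2) \<le> 1"
proof -
  have "2 * pi * (\<Sum>m\<in>S. (cmod (discrete_cauchy_kernel (m, n)))\<^sup>2) \<le>
      integral {0..pi} (\<lambda>t. (multiplier t ^ n)\<^sup>2)"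
    unfolding discrete_cauchy_kernel_eq
    by (intro half_coeff_bessel continuous_intros continuous_on_multiplier assms)
  also have "\<dots> \<le> integral {0..pi} (\<lambda>_. 1)"
  proof (intro integral_le integrable_continuous_interval continuous_intros continuous_on_multiplier)
    fix t assume "t \<in> {0..pi}"
    then have "((multiplier t)\<^sup>2) ^ n \<le> 1"
      by (intro power_le_one multiplier_power2_le_one) auto
    then show "(multiplier t ^ n)\<^sup>2 \<le> 1"
      by (simp add: mult.commute flip: power_mult)
  qed
  also have "\<dots> \<le> 2 * pi * 1" by simp
  finally show ?thesis by simp
qed

section \<open>Correlations of rows\<close>

definition lattice_row :: "(int \<times> nat \<Rightarrow> complex) \<Rightarrow> nat \<Rightarrow> int \<Rightarrow> complex"
  where "lattice_row f n m = f (m, n)"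

text \<open>With no conjugate built in, one notion serves both the Cauchy kernel and its
  conjugate.\<close>

definition correlation :: "(int \<Rightarrow> complex) \<Rightarrow> (int \<Rightarrow> complex) \<Rightarrow> int \<Rightarrow> complex"
  where "correlation a b u = (\<Sum>\<^sub>\<infinity>m. a m * b (m - u))"

section \<open>Linearity and shift rules for correlations\<close>

lemma square_summable_translate:
  "square_summable a \<Longrightarrow> square_summable (\<lambda>m::int. a (m - u))"
  "square_summable a \<Longrightarrow> square_summable (\<lambda>m::int. a (m + u))"
  by (rule square_summable_comp, simp, simp add: inj_on_def)+

lemma correlation_left_linear:
  assumes "square_summable a" "square_summable a'" "square_summable b"
  shows "correlation (\<lambda>m. a m + c * a' m) b u = correlation a b u + c * correlation a' b u"
  unfolding correlation_def
  by (simp add: distrib_right mult.assoc infsum_add infsum_cmult_right' summable_on_cmult_right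
      square_summable_mult square_summable_translate assms)

lemma correlation_right_linear:
  assumes "square_summable a" "square_summable b" "square_summable b'"
  shows "correlation a (\<lambda>m. b m + c * b' m) u = correlation a b u + c * correlation a b' u"
  unfolding correlation_def
  by (simp add: distrib_left mult.left_commute[of _ c] infsum_add infsum_cmult_right'
      summable_on_cmult_right square_summable_mult square_summable_translate assms)

lemma correlation_left_shift: "correlation (\<lambda>m. a (m + 1)) b u = correlation a b (u + 1)"
proof -
  have "bij (\<lambda>m::int. m + 1)"
    by (rule bij_betw_byWitness[where f' = "\<lambda>m. m - 1"]) auto
  from infsum_reindex_bij_betw[OF this, of "\<lambda>m. a m * b (m - (u + 1))"] show ?thesis
    by (simp add: correlation_def)
qed

lemma correlation_right_shift: "correlation a (\<lambda>m. b (m + 1)) (u + 1) = correlation a b u"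
  by (simp add: correlation_def)

text \<open>The relation between two rows becomes a relation in \<open>u\<close>, since shifting the
  left factor by 1 raises \<open>u\<close> by 1.\<close>

lemma correlation_left_relation:
  assumes "square_summable a" "square_summable a'" "square_summable b"
    and "\<And>m. a m + c * a (m + 1) = a' (m + 1) + c * a' m"
  shows "correlation a b u + c * correlation a b (u + 1) =
    correlation a' b (u + 1) + c * correlation a' b u"
  using correlation_left_linear[of a "\<lambda>m. a (m + 1)" b c u]
    correlation_left_linear[of "\<lambda>m. a' (m + 1)" a' b c u]
  by (simp add: assms square_summable_translate correlation_left_shift)

text \<open>A shift of the right factor lowers \<open>u\<close>, so \<open>u\<close> and
  \<open>u + 1\<close> trade places compared with the left relation. For the same \<open>c\<close>,
  a step in the right factor therefore undoes one in the left.\<close>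

lemma correlation_right_relation:
  assumes "square_summable a" "square_summable b" "square_summable b'"
    and "\<And>m. b m + c * b (m + 1) = b' (m + 1) + c * b' m"
  shows "correlation a b (u + 1) + c * correlation a b u =
    correlation a b' u + c * correlation a b' (u + 1)"
  using correlation_right_linear[of a b "\<lambda>m. b (m + 1)" c "u + 1"]
    correlation_right_linear[of a "\<lambda>m. b' (m + 1)" b' c "u + 1"]
  by (simp add: assms square_summable_translate correlation_right_shift)

lemma vanishing_if_constant_modulus:
  fixes d :: "int \<Rightarrow> complex"
  assumes "\<And>u. cmod (d (u + 1)) = cmod (d u)"
    and "(\<lambda>j. d (u + int j)) \<longlonglongrightarrow> 0"
  shows "d u = 0"
proof -
  have "cmod (d (u + int j)) = cmod (d u)" for j
  proof (induction j)
    case (Suc j)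
    then show ?case
      using assms(1)[of "u + int j"] by (simp add: algebra_simps)
  qed simp
  with tendsto_norm[OF assms(2)] show ?thesis
    by (simp add: LIMSEQ_const_iff)
qed

text \<open>A difference of constant modulus in \<open>u\<close> must be 0 because correlations
  decay. This takes the place of cancelling a common factor on the Fourier side.\<close>

lemma correlation_diff_vanishing:
  assumes "square_summable a" "square_summable b" "square_summable a'" "square_summable b'"
    and "\<And>u. cmod (correlation a b (u + 1) - correlation a' b' (u + 1)) =
      cmod (correlation a b u - correlation a' b' u)"
  shows "correlation a b u = correlation a' b' u"
proof -
  have "(\<lambda>j. correlation a b (u + int j) - correlation a' b' (u + int j)) \<longlonglongrightarrow> 0 - 0"
    unfolding correlation_def
    by (intro tendsto_diff correlation_tendsto_zero assms) (auto simp: inj_on_def)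
  then have "correlation a b u - correlation a' b' u = 0"
    by (intro vanishing_if_constant_modulus[of "\<lambda>u. correlation a b u - correlation a' b' u"] assms) simp
  then show ?thesis by simp
qed

text \<open>The hypothesis says that \<open>p' - q'\<close> is \<open>p - q\<close> times
  \<open>- \<i>\<close>.\<close>

lemma norm_eq_if_rotated:
  assumes "(p'::complex) + \<i> * p = q' + \<i> * q"
  shows "cmod (p' - q') = cmod (p - q)"
proof -
  have "p' = q' + \<i> * q - \<i> * p"
    using assms by (simp add: eq_diff_eq)
  then have "p' - q' = - \<i> * (p - q)"
    by (simp add: algebra_simps)
  then show ?thesis
    by (simp add: norm_mult)
qed

section \<open>Exchanging rows between the two factors of a correlation\<close>

lemma row_relation:
  assumes "discrete_holomorphic f"
  shows "lattice_row f n m + \<i> * lattice_row f n (m + 1) = lattice_row f (n + 1) (m + 1) + \<i> * lattice_row f (n + 1) m"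
  using assms[unfolded discrete_holomorphic_def, rule_format, of m n]
  by (simp add: lattice_row_def algebra_simps)

lemma cnj_row_relation:
  assumes "discrete_holomorphic f"
  shows "cnj (lattice_row f n m) + (- \<i>) * cnj (lattice_row f n (m + 1)) =
    cnj (lattice_row f (n + 1) (m + 1)) + (- \<i>) * cnj (lattice_row f (n + 1) m)"
  using arg_cong[OF row_relation[OF assms, of n m], of cnj] by simp

text \<open>Over the upper half-circle the Cauchy kernel has the symbol \<open>r\<^sup>k\<close> with \<open>r = multiplier\<close>, and
  its conjugate has the symbol \<open>r\<^sup>-\<^sup>k\<close> over the lower one. As a step upwards multiplies the symbol
  of a holomorphic function by \<open>r\<close>, a row of the kernel trades against a row of \<open>f\<close> in opposite
  directions in the next two lemmas.\<close>

lemma correlation_cnj_advance: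
  assumes "discrete_holomorphic f" "discrete_holomorphic g"
    and "\<And>n. square_summable (lattice_row f n)" "\<And>n. square_summable (lattice_row g n)"
  shows "correlation (lattice_row f n) (\<lambda>m. cnj (lattice_row g (k + 1) m)) u =
    correlation (lattice_row f (n + 1)) (\<lambda>m. cnj (lattice_row g k m)) u"
proof (rule correlation_diff_vanishing)
  fix u
  let ?A = "\<lambda>n k. correlation (lattice_row f n) (\<lambda>m. cnj (lattice_row g k m))"
  have "?A n k (u + 1) + (- \<i>) * ?A n k u = ?A n (k + 1) u + (- \<i>) * ?A n (k + 1) (u + 1)"
    by (rule correlation_right_relation) (simp_all only: assms square_summable_cnj cnj_row_relation)
  \<comment> \<open>Multiplying by \<open>\<i>\<close> brings the conjugate relation, which carries
    \<open>- \<i>\<close>, to the shape of the left relation; the two then share the side with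
    \<open>?A n k\<close>.\<close>
  then have "\<i> * (?A n k (u + 1) + (- \<i>) * ?A n k u) =
      \<i> * (?A n (k + 1) u + (- \<i>) * ?A n (k + 1) (u + 1))"
    by (rule arg_cong)
  moreover have "?A n k u + \<i> * ?A n k (u + 1) = ?A (n + 1) k (u + 1) + \<i> * ?A (n + 1) k u"
    by (rule correlation_left_relation) (simp_all only: assms square_summable_cnj row_relation)
  ultimately have "?A n (k + 1) (u + 1) + \<i> * ?A n (k + 1) u =
      ?A (n + 1) k (u + 1) + \<i> * ?A (n + 1) k u"
    by (simp add: algebra_simps)
  then show "cmod (?A n (k + 1) (u + 1) - ?A (n + 1) k (u + 1)) =
      cmod (?A n (k + 1) u - ?A (n + 1) k u)"
    by (rule norm_eq_if_rotated)
qed (simp_all add: assms square_summable_cnj)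

lemma correlation_advance:
  assumes "discrete_holomorphic f" "discrete_holomorphic g"
    and "\<And>n. square_summable (lattice_row f n)" "\<And>n. square_summable (lattice_row g n)"
  shows "correlation (lattice_row f n) (lattice_row g k) u = correlation (lattice_row f (n + 1)) (lattice_row g (k + 1)) u"
proof (rule correlation_diff_vanishing)
  fix u
  let ?B = "\<lambda>n k. correlation (lattice_row f n) (lattice_row g k)"
  have "?B n k u + \<i> * ?B n k (u + 1) = ?B (n + 1) k (u + 1) + \<i> * ?B (n + 1) k u"
    by (rule correlation_left_relation) (simp_all only: assms row_relation)
  also have "\<dots> = ?B (n + 1) (k + 1) u + \<i> * ?B (n + 1) (k + 1) (u + 1)"
    by (rule correlation_right_relation) (simp_all only: assms row_relation)
  \<comment> \<open>Here the factor \<open>\<i>\<close> sits at \<open>u + 1\<close> instead of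
    \<open>u\<close>, so the rotation runs the other way and the rule is used reversed.\<close>
  finally show "cmod (?B n k (u + 1) - ?B (n + 1) (k + 1) (u + 1)) =
      cmod (?B n k u - ?B (n + 1) (k + 1) u)"
    by (rule norm_eq_if_rotated[symmetric])
qed (simp_all add: assms)

section \<open>Norms of the rows\<close>

lemma square_summable_row:
  assumes "square_summable f"
  shows "square_summable (lattice_row f n)"
  unfolding lattice_row_def[abs_def] by (rule square_summable_comp[OF assms]) (simp add: inj_on_def)

lemma row_norm_tendsto_zero:
  assumes "square_summable f"
  shows "(\<lambda>n. l2_norm (lattice_row f n)) \<longlonglongrightarrow> 0"
proof -
  \<comment> \<open>The swap puts the row index first, so that the iterated sum has the rows on the
    outside.\<close>
  have "square_summable (\<lambda>z. f (prod.swap z))"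
    by (rule square_summable_comp[OF assms]) simp
  then have "(\<lambda>(n, m). (cmod (f (m, n)))\<^sup>2) summable_on UNIV \<times> UNIV"
    unfolding square_summable_def by (simp add: case_prod_unfold prod.swap_def)
  then have "(\<lambda>n. (l2_norm (lattice_row f n))\<^sup>2) summable_on UNIV"
    unfolding l2_norm_power2 lattice_row_def by (rule summable_on_Sigma_banach)
  then have "(\<lambda>n. sqrt ((l2_norm (lattice_row f n))\<^sup>2)) \<longlonglongrightarrow> sqrt 0"
    by (intro tendsto_real_sqrt summable_LIMSEQ_zero summable_on_imp_summable)
  then show ?thesis
    by (simp add: l2_norm_nonneg)
qed

lemma square_summable_cauchy_row: "square_summable (lattice_row discrete_cauchy_kernel k)"
  by (rule square_summable_bounded[of _ 1]) (simp add: lattice_row_def cauchy_kernel_row_bound)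

lemma l2_norm_cauchy_row: "l2_norm (lattice_row discrete_cauchy_kernel k) \<le> 1"
  by (rule l2_norm_le) (simp_all add: lattice_row_def cauchy_kernel_row_bound)

section \<open>The reproducing property\<close>

text \<open>Both rows can be moved up by any \<open>k\<close>; the correlation is then at most the
  norm of row \<open>n + k\<close> of \<open>f\<close>, which tends to 0.\<close>

lemma correlation_cauchy_zero:
  assumes "f \<in> bergman_space"
  shows "correlation (lattice_row f n) (lattice_row discrete_cauchy_kernel 0) u = 0"
proof -
  let ?C = "discrete_cauchy_kernel"
  have f: "discrete_holomorphic f" "square_summable f"
    using assms by (auto simp: bergman_space_iff)
  note ss = square_summable_row[OF f(2)] square_summable_cauchy_row
  have adv: "correlation (lattice_row f n) (lattice_row ?C 0) u = correlation (lattice_row f (n + k)) (lattice_row ?C k) u" for k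
  proof (induction k)
    case (Suc k)
    then show ?case
      using correlation_advance[OF f(1) discrete_holomorphic_cauchy_kernel ss, of "n + k" k u] by simp
  qed simp
  have "cmod (correlation (lattice_row f n) (lattice_row ?C 0) u) \<le> l2_norm (lattice_row f (n + k))" for k
  proof -
    have "cmod (correlation (lattice_row f n) (lattice_row ?C 0) u) \<le> l2_norm (lattice_row f (n + k)) * l2_norm (lattice_row ?C k)"
      unfolding adv[of k] unfolding correlation_def l2_norm_shift[of "lattice_row ?C k" u, symmetric]
      by (intro cauchy_schwarz_infsum ss square_summable_translate)
    also have "\<dots> \<le> l2_norm (lattice_row f (n + k)) * 1"
      by (intro mult_left_mono l2_norm_cauchy_row l2_norm_nonneg)
    finally show ?thesis by simp
  qed
  moreover have "(\<lambda>k. l2_norm (lattice_row f (n + k))) \<longlonglongrightarrow> 0"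
    using LIMSEQ_ignore_initial_segment[OF row_norm_tendsto_zero[OF f(2)], of n]
    by (simp add: add.commute)
  ultimately have "cmod (correlation (lattice_row f n) (lattice_row ?C 0) u) \<le> 0"
    by (intro LIMSEQ_le_const[of _ 0]) auto
  then show ?thesis by simp
qed

lemma correlation_cnj_cauchy_zero:
  assumes "f \<in> bergman_space"
  shows "correlation (lattice_row f n) (\<lambda>m. cnj (lattice_row discrete_cauchy_kernel 0 m)) u = f (u, n)"
proof -
  let ?b = "lattice_row discrete_cauchy_kernel 0"
  have f: "square_summable (lattice_row f n)"
    using assms by (auto simp: bergman_space_iff intro: square_summable_row)
  have delta: "cnj (?b m) + 1 * ?b m = (if m = 0 then 1 else 0)" for m
    using half_coeff_one_plus_cnj[of m] by (simp add: lattice_row_def discrete_cauchy_kernel_eq add.commute)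
  \<comment> \<open>The added correlation is 0, and it completes the conjugate row to the unit mass
    at 0.\<close>
  have "correlation (lattice_row f n) (\<lambda>m. cnj (?b m)) u =
      correlation (lattice_row f n) (\<lambda>m. cnj (?b m)) u + 1 * correlation (lattice_row f n) ?b u"
    by (simp add: correlation_cauchy_zero[OF assms])
  also have "\<dots> = correlation (lattice_row f n) (\<lambda>m. cnj (?b m) + 1 * ?b m) u"
    by (intro correlation_right_linear[symmetric] f)
       (simp_all add: square_summable_cnj square_summable_cauchy_row)
  also have "\<dots> = (\<Sum>\<^sub>\<infinity>m\<in>{u}. lattice_row f n m)"
    unfolding delta correlation_def by (rule infsum_cong_neutral) auto
  finally show ?thesis
    by (simp add: lattice_row_def)
qed

text \<open>Each step lowers the kernel row and raises the row of \<open>f\<close>, which is why the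
  induction on \<open>k\<close> leaves \<open>n\<close> arbitrary.\<close>

lemma correlation_cnj_cauchy:
  assumes "f \<in> bergman_space"
  shows "correlation (lattice_row f n) (\<lambda>m. cnj (lattice_row discrete_cauchy_kernel k m)) u = f (u, n + k)"
proof (induction k arbitrary: n)
  case 0
  then show ?case
    by (simp add: correlation_cnj_cauchy_zero[OF assms])
next
  case (Suc k)
  have f: "discrete_holomorphic f" "square_summable f"
    using assms by (auto simp: bergman_space_iff)
  show ?case
    using correlation_cnj_advance[OF f(1) discrete_holomorphic_cauchy_kernel
        square_summable_row[OF f(2)] square_summable_cauchy_row, of n k u] Suc[of "n + 1"]
    by simp
qed

text \<open>This is the reproducing kernel at the origin; the kernel at \<open>(u, v)\<close> is its
  translate by \<open>(- u, v)\<close>.\<close>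

definition kernel_difference :: "int \<times> nat \<Rightarrow> complex"
  where "kernel_difference = (\<lambda>(m, n). discrete_cauchy_kernel (m, n) - discrete_cauchy_kernel (m, n + 2))"

lemma discrete_holomorphic_translate:
  assumes "discrete_holomorphic f"
  shows "discrete_holomorphic (\<lambda>(m, n). f (m - u, n + v))"
  using assms unfolding discrete_holomorphic_def by (simp add: diff_add_eq[symmetric])

lemma discrete_holomorphic_kernel_difference: "discrete_holomorphic kernel_difference"
proof -
  have eq: "kernel_difference = (\<lambda>z. discrete_cauchy_kernel z +
      (- 1) * (case z of (m, n) \<Rightarrow> discrete_cauchy_kernel (m - 0, n + 2)))"
    by (auto simp: kernel_difference_def fun_eq_iff)
  show ?thesis
    unfolding eq by (rule discrete_holomorphic_add[OF discrete_holomorphic_cauchy_kernel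
        discrete_holomorphic_scale[OF discrete_holomorphic_translate[OF
          discrete_holomorphic_cauchy_kernel]]])
qed

lemma kernel_difference_eq:
  "kernel_difference (m, n) = half_coeff (\<lambda>t. multiplier t ^ n - multiplier t ^ (n + 2)) m"
  unfolding kernel_difference_def discrete_cauchy_kernel_eq prod.case
  by (intro half_coeff_diff[symmetric] continuous_intros continuous_on_multiplier)

text \<open>Bessel's inequality is applied row by row and the rows are summed under the integral.
  With \<open>q\<close> the squared multiplier this leaves a geometric series in \<open>q\<close>,
  and the factor \<open>(1 - q)\<^sup>2\<close> from the difference keeps the sum bounded by
  1.\<close>

lemma square_summable_kernel_difference: "square_summable kernel_difference"
proof (rule square_summable_bounded)
  fix T :: "(int \<times> nat) set"
  assume T: "finite T"
  define S where "S = fst ` T"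
  \<comment> \<open>Inserting 0 covers an empty \<open>T\<close>, and \<open>Suc\<close> makes the
    bound on the rows strict.\<close>
  define N where "N = Suc (Max (insert 0 (snd ` T)))"
  have S: "finite S"
    using T by (simp add: S_def)
  have sub: "T \<subseteq> S \<times> {..<N}"
  proof
    fix z assume "z \<in> T"
    then have "snd z \<le> Max (insert 0 (snd ` T))"
      using T by (intro Max_ge) auto
    then show "z \<in> S \<times> {..<N}"
      using \<open>z \<in> T\<close> by (cases z) (force simp: S_def N_def)
  qed
  let ?h = "\<lambda>n t. multiplier t ^ n - multiplier t ^ (n + 2)"
  have cont: "continuous_on {0..pi} (?h n)" for n
    by (intro continuous_intros continuous_on_multiplier)
  have "2 * pi * (\<Sum>z\<in>T. (cmod (kernel_difference z))\<^sup>2) \<le>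
      2 * pi * (\<Sum>z\<in>S \<times> {..<N}. (cmod (kernel_difference z))\<^sup>2)"
    using S by (intro mult_left_mono sum_mono2 sub) auto
  also have "\<dots> = (\<Sum>n<N. 2 * pi * (\<Sum>m\<in>S. (cmod (half_coeff (?h n) m))\<^sup>2))"
    unfolding kernel_difference_eq[symmetric]
    by (subst sum.cartesian_product[symmetric, where g = "\<lambda>m n. (cmod (kernel_difference (m, n)))\<^sup>2",
          unfolded case_prod_unfold, simplified], subst sum.swap) (simp add: sum_distrib_left)
  also have "\<dots> \<le> (\<Sum>n<N. integral {0..pi} (\<lambda>t. (?h n t)\<^sup>2))"
    by (intro sum_mono half_coeff_bessel cont S)
  also have "\<dots> = integral {0..pi} (\<lambda>t. \<Sum>n<N. (?h n t)\<^sup>2)"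
    by (intro Henstock_Kurzweil_Integration.integral_sum[symmetric] integrable_continuous_interval
        continuous_intros continuous_on_multiplier) simp
  also have "\<dots> \<le> integral {0..pi} (\<lambda>_. 1)"
  proof (intro integral_le integrable_continuous_interval continuous_intros continuous_on_multiplier)
    fix t assume "t \<in> {0..pi}"
    define q where "q = (multiplier t)\<^sup>2"
    have q: "0 \<le> q" "q \<le> 1"
      using multiplier_power2_le_one[OF \<open>t \<in> {0..pi}\<close>] by (auto simp: q_def)
    have "(?h n t)\<^sup>2 = (1 - q) * ((1 - q) * q ^ n)" for n
    proof -
      have "?h n t = (1 - q) * multiplier t ^ n"
        by (simp add: q_def power_add algebra_simps power2_eq_square)
      then show ?thesis
        by (simp add: q_def power_mult_distrib power2_eq_square flip: power_mult power_add)
    qed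
    then have "(\<Sum>n<N. (?h n t)\<^sup>2) = (1 - q) * ((1 - q) * (\<Sum>n<N. q ^ n))"
      by (simp add: sum_distrib_left)
    \<comment> \<open>The geometric sum is evaluated without division, so \<open>q = 1\<close> at
      the endpoints is no exception.\<close>
    also have "\<dots> = (1 - q) * (1 - q ^ N)"
      by (simp add: one_diff_power_eq)
    also have "\<dots> \<le> 1 * 1"
      using q by (intro mult_mono) (auto simp: power_le_one)
    finally show "(\<Sum>n<N. (?h n t)\<^sup>2) \<le> 1" by simp
  qed
  also have "\<dots> = pi" by simp
  finally show "(\<Sum>z\<in>T. (cmod (kernel_difference z))\<^sup>2) \<le> 1 / 2"
    using pi_gt_zero by (simp add: field_simps)
qed

text \<open>Fubini's theorem with the coordinates swapped, so that the rows form the outer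
  sum.\<close>

lemma bergman_inner_rows:
  assumes "square_summable f" "square_summable g"
  shows "((\<lambda>n. \<Sum>\<^sub>\<infinity>m. lattice_row f n m * cnj (lattice_row g n m)) has_sum bergman_inner f g) UNIV"
proof -
  have "(\<lambda>z. f z * cnj (g z)) summable_on UNIV"
    using assms by (intro square_summable_mult) (simp_all add: square_summable_cnj)
  then have sw: "(\<lambda>(n, m). f (m, n) * cnj (g (m, n))) summable_on UNIV \<times> UNIV"
    using summable_on_reindex_bij_betw[OF bij_swap, of "\<lambda>z. f z * cnj (g z)"]
    by (simp add: case_prod_unfold prod.swap_def)
  have "bergman_inner f g = (\<Sum>\<^sub>\<infinity>(n, m)\<in>UNIV \<times> UNIV. f (m, n) * cnj (g (m, n)))"
    using infsum_reindex_bij_betw[OF bij_swap, of "\<lambda>z. f z * cnj (g z)"]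
    by (simp add: bergman_inner_def case_prod_unfold prod.swap_def)
  then show ?thesis
    using summable_on_Sigma_banach[OF sw] infsum_Sigma'_banach[OF sw]
    by (simp add: lattice_row_def has_sum_iff)
qed

lemma kernel_translate_mem: "(\<lambda>(m, n). kernel_difference (m - u, n + v)) \<in> bergman_space"
proof -
  have "square_summable (\<lambda>z. kernel_difference (fst z - u, snd z + v))"
    by (rule square_summable_comp[OF square_summable_kernel_difference]) (auto simp: inj_on_def)
  then show ?thesis
    using discrete_holomorphic_translate[OF discrete_holomorphic_kernel_difference]
    by (simp add: bergman_space_iff case_prod_unfold)
qed

lemma kernel_reproducing:
  assumes "f \<in> bergman_space"
  shows "f (u, v) = bergman_inner f (\<lambda>(m, n). kernel_difference (m - u, n + v))"
proof -
  let ?K = "\<lambda>(m, n). kernel_difference (m - u, n + v)"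
  let ?C = "discrete_cauchy_kernel"
  have f: "square_summable f" and K: "square_summable ?K"
    using assms kernel_translate_mem[of u v] by (simp_all only: bergman_space_iff)
  \<comment> \<open>Row \<open>n\<close> of \<open>f\<close> against kernel row \<open>n + v\<close>
    returns \<open>f\<close> at height \<open>2 * n + v\<close>; the second kernel, two rows higher,
    returns the height belonging to \<open>Suc n\<close>. Hence the sum over rows
    telescopes.\<close>
  define g where "g n = f (u, 2 * n + v)" for n
  have rows: "(\<Sum>\<^sub>\<infinity>m. lattice_row f n m * cnj (lattice_row ?K n m)) = g n - g (Suc n)" for n
  proof -
    have "(\<Sum>\<^sub>\<infinity>m. lattice_row f n m * cnj (lattice_row ?K n m)) =
        correlation (lattice_row f n) (\<lambda>m. cnj (lattice_row ?C (n + v) m) + (- 1) * cnj (lattice_row ?C (n + v + 2) m)) u"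
      by (simp add: correlation_def lattice_row_def kernel_difference_def)
    also have "\<dots> = f (u, n + (n + v)) + (- 1) * f (u, n + (n + v + 2))"
      by (subst correlation_right_linear)
         (simp_all only: square_summable_row[OF f] square_summable_cnj square_summable_cauchy_row
           correlation_cnj_cauchy[OF assms])
    also have "\<dots> = g n - g (Suc n)"
      by (simp add: g_def mult_2 add.assoc)
    finally show ?thesis .
  qed
  have "g \<longlonglongrightarrow> 0"
    unfolding g_def by (rule square_summable_tendsto_zero[OF f]) (simp add: inj_on_def)
  then have "(\<lambda>n. g n - g (Suc n)) sums (g 0 - 0)"
    by (rule telescope_sums')
  moreover have "(\<lambda>n. g n - g (Suc n)) sums bergman_inner f ?K"
    using bergman_inner_rows[OF f K] unfolding rows by (rule has_sum_imp_sums)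
  ultimately show ?thesis
    by (simp add: sums_unique2 g_def)
qed

lemma kernel_is_reproducing:
  "is_reproducing_kernel_at bergman_space bergman_inner (u, v)
    (\<lambda>(m, n). kernel_difference (m - u, n + v))"
  unfolding is_reproducing_kernel_at_def using kernel_translate_mem kernel_reproducing by blast

theorem corollary8p2:
  "reproducing_kernel_hilbert_space bergman_space bergman_inner \<and>
   (\<forall>w. \<exists>!B. is_reproducing_kernel_at bergman_space bergman_inner w B) \<and>
   (\<forall>(m::int) (n::nat) (u::int) (v::nat).
      bergman_kernel (u, v) (m, n) =
        discrete_cauchy_kernel (m - u, n + v) - discrete_cauchy_kernel (m - u, n + v + 2) \<and>
      discrete_cauchy_kernel (m - u, n + v) - discrete_cauchy_kernel (m - u, n + v + 2) =
        1 / (2 * of_real pi) *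
        integral {0..pi} (\<lambda>t. exp (\<i> * of_int (m - u) * of_real t) *
                             of_real ((cos t / (1 + sin t)) ^ (n + v)) *
                             of_real (2 * sin t / (1 + sin t))))"
proof (intro conjI allI)
  show "reproducing_kernel_hilbert_space bergman_space bergman_inner"
    by (rule bergman_rkhs)
next
  fix w :: "int \<times> nat"
  obtain u v where w: "w = (u, v)" by (cases w)
  show "\<exists>!B. is_reproducing_kernel_at bergman_space bergman_inner w B"
    unfolding w by (rule ex1I, rule kernel_is_reproducing)
      (rule reproducing_kernel_unique[OF bergman_hilbert _ kernel_is_reproducing])
next
  fix m u :: int and n v :: nat
  have "bergman_kernel (u, v) = (\<lambda>(m, n). kernel_difference (m - u, n + v))"
    unfolding bergman_kernel_def by (rule the_equality, rule kernel_is_reproducing)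
      (rule reproducing_kernel_unique[OF bergman_hilbert _ kernel_is_reproducing])
  then show "bergman_kernel (u, v) (m, n) =
      discrete_cauchy_kernel (m - u, n + v) - discrete_cauchy_kernel (m - u, n + v + 2)"
    by (simp add: kernel_difference_def)
next
  fix m u :: int and n v :: nat
  have "discrete_cauchy_kernel (m - u, n + v) - discrete_cauchy_kernel (m - u, n + v + 2) =
      half_coeff (\<lambda>t. multiplier t ^ (n + v) - multiplier t ^ (n + v + 2)) (m - u)"
    using kernel_difference_eq[of "m - u" "n + v"] by (simp add: kernel_difference_def)
  \<comment> \<open>The exponents differ by 2, so the factor
    \<open>1 - (multiplier t)\<^sup>2\<close> splits off.\<close>
  also have "\<dots> = half_coeff (\<lambda>t. multiplier t ^ (n + v) * (2 * sin t / (1 + sin t))) (m - u)"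
  proof (rule half_coeff_cong)
    fix t assume "t \<in> {0..pi}"
    have "multiplier t ^ (n + v) - multiplier t ^ (n + v + 2) =
        multiplier t ^ (n + v) * (1 - (multiplier t)\<^sup>2)"
      unfolding power_add[of _ "n + v" 2] by (simp add: right_diff_distrib)
    then show "multiplier t ^ (n + v) - multiplier t ^ (n + v + 2) =
        multiplier t ^ (n + v) * (2 * sin t / (1 + sin t))"
      unfolding one_minus_multiplier_power2[OF \<open>t \<in> {0..pi}\<close>] .
  qed
  finally show "discrete_cauchy_kernel (m - u, n + v) - discrete_cauchy_kernel (m - u, n + v + 2) =
      1 / (2 * of_real pi) *
      integral {0..pi} (\<lambda>t. exp (\<i> * of_int (m - u) * of_real t) *
                           of_real ((cos t / (1 + sin t)) ^ (n + v)) *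
                           of_real (2 * sin t / (1 + sin t)))"
    unfolding half_coeff_def character_def multiplier_def of_real_mult mult.assoc .
qed

end
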